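(* Let $W:\mathbb{R}\times\mathbb{R}^d\to\mathbb{R}^d$ be such that, for constants $\tau,\lambda\in(0,1]$, $\beta\ge 0$, the seminorm $\|W\|_{\beta,\tau,\lambda;a,b}$ is finite for all $a<b$, and let $\varphi:\mathbb{R}\to\mathbb{R}^d$ be such that, for some $\gamma\in(0,1]$, $\|\varphi\|_{\gamma;a,b}<\infty$ for all $a<b$. Assume $\tau+\lambda\gamma>1$. Then for all $a<b$ the Riemann sums $J_\pi=\sum_{i=0}^{m-1}[W(t_{i+1},\varphi_{t_i})-W(t_i,\varphi_{t_i})]$ over partitions $\pi=\{a=t_0<t_1<\dots<t_m=b\}$ converge as the mesh size $|\pi|$ goes to $0$; in other words, the nonlinear integral $\int_a^bW(ds,\varphi_s)$ is well defined. In addition, there is a constant $\kappa$, depending only on the exponents and independent of $W$, $\varphi$, $a$, $b$, such that $$\left|\int_s^tW(dr,\varphi_r)-W(t,\varphi_c)+W(s,\varphi_c)\right|\le\kappa\,\|W\|_{\beta,\tau,\lambda;a,b}\,(1+\|\varphi\|_{\infty;a,b}^\beta)\,\|\varphi\|_{\gamma;a,b}^\lambda\,(t-s)^{\tau+\lambda\gamma}$$ for all $a\le s\le c\le t\le b$.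
   Context: For $\tau,\lambda\in(0,1]$, $\beta\ge0$ and $a<b$, $$\|W\|_{\beta,\tau,\lambda;a,b}=\sup_{\substack{a\le s<t\le b\\ x\ne y}}\frac{|W(s,x)-W(t,x)-W(s,y)+W(t,y)|}{(1+|x|+|y|)^\beta|t-s|^\tau|x-y|^\lambda}+\sup_{\substack{a\le s<t\le b\\ x\in\mathbb{R}^d}}\frac{|W(s,x)-W(t,x)|}{(1+|x|)^{\beta+\lambda}|t-s|^\tau}+\sup_{\substack{a\le t\le b\\ x\ne y}}\frac{|W(t,y)-W(t,x)|}{(1+|x|+|y|)^\beta|x-y|^\lambda}.$$ Also $\|\varphi\|_{\gamma;a,b}=\sup_{a\le s<t\le b}|\varphi_t-\varphi_s|/|t-s|^\gamma$ and $\|\varphi\|_{\infty;a,b}=\sup_{a\le t\le b}|\varphi_t|$. The mesh is $|\pi|=\max_i|t_{i+1}-t_i|$, and $\int_a^bW(ds,\varphi_s)$ denotes the limit of $J_\pi$ as $|\pi|\to0$ whenever it exists. *)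

theory Defs
  imports "HOL-Analysis.Analysis" "HOL-Library.Function_Algebras"
begin

text \<open>
  The constant of the estimate must not depend on the dimension \<open>d\<close>, so \<open>d\<close> is quantified inside
  its scope and cannot be given by a type. \<open>R\<^sup>d\<close> is therefore the carrier of the library's
  \<^const>\<open>Euclidean_space\<close>: sequences vanishing from index \<open>d\<close> on, with the pointwise vector
  operations.
\<close>

abbreviation Rd :: "nat \<Rightarrow> (nat \<Rightarrow> real) set"
  where "Rd d \<equiv> topspace (Euclidean_space d)"

abbreviation vnorm :: "nat \<Rightarrow> (nat \<Rightarrow> real) \<Rightarrow> real"
  where "vnorm d x \<equiv> L2_set x {..<d}"

text \<open>
  Suprema are taken in \<^typ>\<open>ennreal\<close>, so that finiteness of a seminorm is \<open>< \<infinity>\<close>.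
  Beware that \<^term>\<open>0 powr 0 = (0::real)\<close>: for \<open>\<beta> = 0\<close> and \<open>\<phi> = 0\<close> on \<open>[a, b]\<close>, a factor
  \<open>1 + (sup norm of \<phi>) powr \<beta>\<close> is \<open>1\<close>, not \<open>2\<close>; this only affects the value of a constant.
\<close>

definition W_seminorm ::
  "nat \<Rightarrow> real \<Rightarrow> real \<Rightarrow> real \<Rightarrow> real \<Rightarrow> real \<Rightarrow> (real \<Rightarrow> (nat \<Rightarrow> real) \<Rightarrow> (nat \<Rightarrow> real)) \<Rightarrow> ennreal"
  where "W_seminorm d \<beta> \<tau> lam a b W =
    (SUP (s, t, x, y) \<in> {(s, t, x, y). a \<le> s \<and> s < t \<and> t \<le> b \<and> x \<in> Rd d \<and> y \<in> Rd d \<and> x \<noteq> y}.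
       ennreal (vnorm d (W s x - W t x - W s y + W t y)
         / ((1 + vnorm d x + vnorm d y) powr \<beta> * \<bar>t - s\<bar> powr \<tau> * vnorm d (x - y) powr lam)))
  + (SUP (s, t, x) \<in> {(s, t, x). a \<le> s \<and> s < t \<and> t \<le> b \<and> x \<in> Rd d}.
       ennreal (vnorm d (W s x - W t x)
         / ((1 + vnorm d x) powr (\<beta> + lam) * \<bar>t - s\<bar> powr \<tau>)))
  + (SUP (t, x, y) \<in> {(t, x, y). a \<le> t \<and> t \<le> b \<and> x \<in> Rd d \<and> y \<in> Rd d \<and> x \<noteq> y}.
       ennreal (vnorm d (W t y - W t x)
         / ((1 + vnorm d x + vnorm d y) powr \<beta> * vnorm d (x - y) powr lam)))"

definition holder_seminorm ::
  "nat \<Rightarrow> real \<Rightarrow> real \<Rightarrow> real \<Rightarrow> (real \<Rightarrow> (nat \<Rightarrow> real)) \<Rightarrow> ennreal"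
  where "holder_seminorm d \<gamma> a b \<phi> =
    (SUP (s, t) \<in> {(s, t). a \<le> s \<and> s < t \<and> t \<le> b}.
       ennreal (vnorm d (\<phi> t - \<phi> s) / \<bar>t - s\<bar> powr \<gamma>))"

definition sup_norm :: "nat \<Rightarrow> real \<Rightarrow> real \<Rightarrow> (real \<Rightarrow> (nat \<Rightarrow> real)) \<Rightarrow> ennreal"
  where "sup_norm d a b \<phi> = (SUP t \<in> {a..b}. ennreal (vnorm d (\<phi> t)))"

text \<open>
  A partition \<open>a = t\<^sub>0 < \<dots> < t\<^sub>m = b\<close> is the list of its points. For \<open>a = b\<close> the only one is
  the singleton list (\<open>m = 0\<close>), whose mesh is \<open>0\<close> and whose Riemann sum is empty.
\<close>

definition interval_partition :: "real \<Rightarrow> real \<Rightarrow> real list \<Rightarrow> bool"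
  where "interval_partition a b ts \<longleftrightarrow>
    ts \<noteq> [] \<and> hd ts = a \<and> last ts = b \<and> sorted_wrt (<) ts"

definition mesh_size :: "real list \<Rightarrow> real"
  where "mesh_size ts = Max (insert 0 ((\<lambda>i. \<bar>ts ! Suc i - ts ! i\<bar>) ` {..<length ts - 1}))"

definition mesh_to_zero :: "real \<Rightarrow> real \<Rightarrow> real list filter"
  where "mesh_to_zero a b =
    (INF \<delta>\<in>{0<..}. principal {ts. interval_partition a b ts \<and> mesh_size ts < \<delta>})"

definition riemann_sum ::
  "(real \<Rightarrow> (nat \<Rightarrow> real) \<Rightarrow> (nat \<Rightarrow> real)) \<Rightarrow> (real \<Rightarrow> (nat \<Rightarrow> real)) \<Rightarrow> real list \<Rightarrow> (nat \<Rightarrow> real)"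
  where "riemann_sum W \<phi> ts =
    (\<Sum>i<length ts - 1. W (ts ! Suc i) (\<phi> (ts ! i)) - W (ts ! i) (\<phi> (ts ! i)))"

definition has_nonlinear_integral ::
  "nat \<Rightarrow> (real \<Rightarrow> (nat \<Rightarrow> real) \<Rightarrow> (nat \<Rightarrow> real)) \<Rightarrow> (real \<Rightarrow> (nat \<Rightarrow> real)) \<Rightarrow> real \<Rightarrow> real
    \<Rightarrow> (nat \<Rightarrow> real) \<Rightarrow> bool"
  where "has_nonlinear_integral d W \<phi> a b l \<longleftrightarrow>
    limitin (Euclidean_space d) (riemann_sum W \<phi>) l (mesh_to_zero a b)"

definition nonlinear_integral ::
  "nat \<Rightarrow> (real \<Rightarrow> (nat \<Rightarrow> real) \<Rightarrow> (nat \<Rightarrow> real)) \<Rightarrow> (real \<Rightarrow> (nat \<Rightarrow> real)) \<Rightarrow> real \<Rightarrow> real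
    \<Rightarrow> (nat \<Rightarrow> real)"
  where "nonlinear_integral d W \<phi> a b = (THE l. has_nonlinear_integral d W \<phi> a b l)"

end

theory Submission
  imports Defs
begin

text \<open>
  The germ \<open>A s t = W t (\<phi> s) - W s (\<phi> s)\<close> is almost additive: its defect
  \<open>A s t - A s u - A u t\<close> is a mixed increment of \<open>W\<close>, hence at most \<open>C (t - s)\<^sup>\<theta>\<close> with
  \<open>\<theta> = \<tau> + \<lambda>\<gamma> > 1\<close>. Cutting a partition of \<open>[s, t]\<close> at the two points around its midpoint shows
  by induction that every Riemann sum differs from \<open>A s t\<close> by at most \<open>K (t - s)\<^sup>\<theta>\<close>, where
  \<open>K = 2C + 2\<^sup>1\<^sup>-\<^sup>\<theta> K\<close>. By compactness there is then a function \<open>F\<close> on \<open>[a, b]\<close> whose increments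
  are within \<open>K (t - s)\<^sup>\<theta>\<close> of \<open>A s t\<close> for all \<open>s \<le> t\<close>. Telescoping bounds the distance of a
  Riemann sum from \<open>F b - F a\<close> by \<open>K |\<pi>|\<^sup>\<theta>\<^sup>-\<^sup>1 (b - a)\<close>, so these increments are the
  integrals.
\<close>

section \<open>The Euclidean norm on sequences\<close>

lemma vnorm_add_le: "vnorm d (x + y) \<le> vnorm d x + vnorm d y"
  unfolding plus_fun_def by (rule L2_set_triangle_ineq)

lemma vnorm_uminus: "vnorm d (- x) = vnorm d x"
  by (simp add: L2_set_def)

lemma vnorm_diff_le: "vnorm d (x - y) \<le> vnorm d x + vnorm d y"
  using vnorm_add_le[of x "- y" d] by (simp add: vnorm_uminus)

lemma vnorm_minus_commute: "vnorm d (x - y) = vnorm d (y - x)"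
  using vnorm_uminus[of "x - y" d] by simp

lemma vnorm_sum_le: "vnorm d (sum f I) \<le> (\<Sum>i\<in>I. vnorm d (f i))"
proof (induction I rule: infinite_finite_induct)
  case (insert i I)
  have "vnorm d (sum f (insert i I)) = vnorm d (f i + sum f I)"
    by (simp only: sum.insert[OF insert.hyps])
  also have "\<dots> \<le> vnorm d (f i) + vnorm d (sum f I)"
    by (rule vnorm_add_le)
  also have "\<dots> \<le> vnorm d (f i) + (\<Sum>i\<in>I. vnorm d (f i))"
    using insert.IH by (rule add_left_mono)
  finally show ?case
    by (simp only: sum.insert[OF insert.hyps])
qed (simp_all add: L2_set_def)

lemma abs_le_vnorm: "i < d \<Longrightarrow> \<bar>x i\<bar> \<le> vnorm d x"
  using member_le_L2_set[of "{..<d}" i "\<lambda>i. \<bar>x i\<bar>"] by (simp add: L2_set_def)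

text \<open>Coordinates from \<open>d\<close> on are invisible to \<open>vnorm d\<close>;
  definiteness comes from the fact that on \<open>Rd d\<close> these coordinates vanish.\<close>

lemma vnorm_pos:
  assumes "x \<in> Rd d" "y \<in> Rd d" "x \<noteq> y"
  shows "vnorm d (x - y) > 0"
proof (rule ccontr)
  assume "\<not> ?thesis"
  then have "vnorm d (x - y) = 0"
    by (simp add: order.antisym not_less)
  then have "\<forall>i<d. x i = y i"
    by (simp add: L2_set_eq_0_iff)
  then have "x = y"
    using assms(1,2) by (auto simp: topspace_Euclidean_space fun_eq_iff) (metis not_less)
  then show False using assms(3) by simp
qed

section \<open>Compactness, closedness and convergence in product topologies\<close>

text \<open>Tychonoff's theorem on a function type. In \<open>sewing\<close> it is applied twice:
  over the coordinates and over the times.\<close>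

lemma compact_product_UNIV:
  fixes S :: "'i \<Rightarrow> 'b::topological_space set"
  assumes "\<And>i. compact (S i)"
  shows "compact {f. \<forall>i. f i \<in> S i}"
proof -
  have "{f. \<forall>i. f i \<in> S i} = PiE UNIV S"
    by (auto simp: PiE_def)
  then show ?thesis
    using assms compactin_PiE[of "\<lambda>_. euclidean" UNIV S]
    by (simp add: euclidean_product_topology)
qed

text \<open>The condition reads only finitely many real numbers \<open>F t i\<close> and
  \<open>F s i\<close>, and each is continuous in \<open>F\<close> for pointwise
  convergence.\<close>

lemma closed_vnorm_increment_le:
  fixes c :: "nat \<Rightarrow> real"
  shows "closed {F :: 'a \<Rightarrow> nat \<Rightarrow> real. vnorm d (F t - F s - c) \<le> r}"
proof -
  have "continuous_on UNIV (\<lambda>F :: 'a \<Rightarrow> nat \<Rightarrow> real. F t i)" for t i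
    by (rule continuous_on_compose2[of UNIV "\<lambda>f. f i" UNIV "\<lambda>F. F t"]) auto
  then have "continuous_on UNIV (\<lambda>F :: 'a \<Rightarrow> nat \<Rightarrow> real. vnorm d (F t - F s - c))"
    unfolding L2_set_def fun_diff_def by (intro continuous_intros)
  then show ?thesis
    by (intro closed_Collect_le) auto
qed

text \<open>Convergence in \<open>Euclidean_space d\<close> is coordinatewise: coordinates below
  \<open>d\<close> are dominated by the norm, all others are constantly \<open>0\<close>.\<close>

lemma limitin_Euclidean_spaceI:
  assumes "l \<in> Rd d" "\<And>x. f x \<in> Rd d" "((\<lambda>x. vnorm d (f x - l)) \<longlongrightarrow> 0) F"
  shows "limitin (Euclidean_space d) f l F"
proof -
  have lim: "((\<lambda>x. f x i) \<longlongrightarrow> l i) F" for i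
  proof (cases "i < d")
    case True
    show ?thesis
    proof (rule LIM_zero_cancel, rule Lim_null_comparison[OF _ assms(3)])
      show "\<forall>\<^sub>F x in F. norm (f x i - l i) \<le> vnorm d (f x - l)"
        using abs_le_vnorm[OF True, of "f _ - l"] by (intro always_eventually allI) simp
    qed
  next
    case False
    then have "f x i = 0" "l i = 0" for x
      using assms(1,2) by (simp_all add: topspace_Euclidean_space)
    then show ?thesis by simp
  qed
  have "limitin euclideanreal (\<lambda>x. f x i) (l i) F" for i
    using lim by (simp only: limitin_canonical_iff)
  then have "limitin (powertop_real UNIV) f l F"
    by (intro limitin_componentwise[THEN iffD2]) (auto simp del: limitin_canonical_iff)
  with assms(1,2) show ?thesis
    unfolding Euclidean_space_def limitin_subtopology
    by (metis (no_types, lifting) Euclidean_space_def topspace_Euclidean_space always_eventually)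
qed

section \<open>Partitions of vanishing mesh\<close>

lemma interval_partition_nth:
  assumes "interval_partition a b ts"
  shows "ts ! 0 = a" "ts ! (length ts - 1) = b"
    and "Suc i < length ts \<Longrightarrow> ts ! i < ts ! Suc i"
    and "i < length ts \<Longrightarrow> a \<le> ts ! i \<and> ts ! i \<le> b"
proof -
  have ts: "ts \<noteq> []" "hd ts = a" "last ts = b" "\<And>i j. i < j \<Longrightarrow> j < length ts \<Longrightarrow> ts ! i < ts ! j"
    using assms by (auto simp: interval_partition_def sorted_wrt_iff_nth_less)
  show ends: "ts ! 0 = a" "ts ! (length ts - 1) = b"
    using ts(1-3) by (simp_all add: hd_conv_nth last_conv_nth)
  show "Suc i < length ts \<Longrightarrow> ts ! i < ts ! Suc i"
    using ts(4) by simp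
  show "i < length ts \<Longrightarrow> a \<le> ts ! i \<and> ts ! i \<le> b"
  proof
    assume i: "i < length ts"
    then show "a \<le> ts ! i"
      using ts(4)[of 0 i] ends by (cases "i = 0") auto
    show "ts ! i \<le> b"
    proof (cases "i = length ts - 1")
      case False
      then have "i < length ts - 1" "length ts - 1 < length ts" using i by linarith+
      then show ?thesis using ts(4)[of i "length ts - 1"] ends by linarith
    qed (use ends in simp)
  qed
qed

lemma mesh_size_nonneg: "mesh_size ts \<ge> 0"
  by (simp add: mesh_size_def)

lemma step_le_mesh_size: "Suc i < length ts \<Longrightarrow> ts ! Suc i - ts ! i \<le> mesh_size ts"
  unfolding mesh_size_def
  by (rule order_trans[OF abs_ge_self]) (intro Max_ge, auto)

lemma mesh_size_less:
  assumes "\<delta> > 0" "\<And>i. Suc i < length ts \<Longrightarrow> \<bar>ts ! Suc i - ts ! i\<bar> < \<delta>"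
  shows "mesh_size ts < \<delta>"
proof -
  have "\<bar>ts ! Suc i - ts ! i\<bar> < \<delta>" if "i < length ts - 1" for i
    using that by (intro assms(2)) linarith
  with \<open>\<delta> > 0\<close> show ?thesis
    unfolding mesh_size_def by (subst Max_less_iff) blast+
qed

text \<open>The smaller of two mesh bounds serves for both, so the principal filters form a base and
  a single \<open>\<delta>\<close> suffices.\<close>

lemma eventually_mesh_to_zero:
  "eventually P (mesh_to_zero a b) \<longleftrightarrow>
    (\<exists>\<delta>>0. \<forall>ts. interval_partition a b ts \<longrightarrow> mesh_size ts < \<delta> \<longrightarrow> P ts)"
  unfolding mesh_to_zero_def
proof (subst eventually_INF_base)
  fix \<delta> \<epsilon> :: real
  assume "\<delta> \<in> {0<..}" "\<epsilon> \<in> {0<..}"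
  then show "\<exists>x\<in>{0<..}. principal {ts. interval_partition a b ts \<and> mesh_size ts < x}
      \<le> inf (principal {ts. interval_partition a b ts \<and> mesh_size ts < \<delta>})
        (principal {ts. interval_partition a b ts \<and> mesh_size ts < \<epsilon>})"
    by (intro bexI[of _ "min \<delta> \<epsilon>"]) auto
qed (auto simp: eventually_principal)

lemma mesh_size_tendsto_zero: "(mesh_size \<longlongrightarrow> 0) (mesh_to_zero a b)"
proof (rule tendstoI)
  fix e :: real
  assume "e > 0"
  then show "\<forall>\<^sub>F ts in mesh_to_zero a b. dist (mesh_size ts) 0 < e"
    unfolding eventually_mesh_to_zero by (intro exI[of _ e]) (simp add: mesh_size_nonneg)
qed

text \<open>Equidistant points do it. This keeps the mesh filter from being \<open>bot\<close>,
  along which every point would be a limit.\<close>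

lemma fine_interval_partition_exists:
  assumes "a \<le> b" "\<delta> > 0"
  shows "\<exists>ts. interval_partition a b ts \<and> mesh_size ts < \<delta>"
proof (cases "a = b")
  case True
  then show ?thesis
    using assms by (intro exI[of _ "[a]"]) (simp add: interval_partition_def mesh_size_def)
next
  case False
  obtain n :: nat where n: "n > (b - a) / \<delta>"
    using reals_Archimedean2 by blast
  have "n > 0"
    using n assms by (cases n) (auto simp: field_simps)
  define ts where "ts = map (\<lambda>i. a + real i * ((b - a) / n)) [0..<Suc n]"
  have len: "length ts = Suc n" by (simp add: ts_def)
  have nth: "ts ! i = a + real i * ((b - a) / n)" if "i \<le> n" for i
    using that by (simp add: ts_def nth_append del: upt_Suc)
  have "interval_partition a b ts"
    unfolding interval_partition_def
  proof (intro conjI)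
    show "ts \<noteq> []" using len by auto
    then show "hd ts = a" "last ts = b"
      using nth[of 0] nth[of n] len \<open>n > 0\<close> by (simp_all add: hd_conv_nth last_conv_nth)
    show "sorted_wrt (<) ts"
      unfolding sorted_wrt_iff_nth_less len
      using nth \<open>n > 0\<close> False assms by (auto intro!: divide_strict_right_mono mult_strict_right_mono)
  qed
  moreover have "mesh_size ts < \<delta>"
  proof (rule mesh_size_less[OF \<open>\<delta> > 0\<close>])
    fix i assume "Suc i < length ts"
    then have "ts ! Suc i - ts ! i = (b - a) / n"
      using nth[of i] nth[of "Suc i"] len by (simp add: algebra_simps add_divide_distrib diff_divide_distrib)
    moreover have "0 \<le> (b - a) / n" "(b - a) / n < \<delta>"
      using n \<open>n > 0\<close> assms by (simp_all add: field_simps)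
    ultimately show "\<bar>ts ! Suc i - ts ! i\<bar> < \<delta>"
      by linarith
  qed
  ultimately show ?thesis by blast
qed

lemma mesh_to_zero_nontrivial: "a \<le> b \<Longrightarrow> mesh_to_zero a b \<noteq> bot"
  using fine_interval_partition_exists by (simp add: trivial_limit_def eventually_mesh_to_zero)

text \<open>The description by \<open>THE\<close> is unambiguous because the filter is nontrivial
  and the space is Hausdorff.\<close>

lemma nonlinear_integral_eqI:
  assumes "a \<le> b" "has_nonlinear_integral d W \<phi> a b l"
  shows "nonlinear_integral d W \<phi> a b = l"
  unfolding nonlinear_integral_def
proof (rule the_equality[of "has_nonlinear_integral d W \<phi> a b", OF assms(2)])
  fix k
  assume "has_nonlinear_integral d W \<phi> a b k"
  then show "k = l"
    using assms(2) mesh_to_zero_nontrivial[OF assms(1)] Hausdorff_Euclidean_space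
    unfolding has_nonlinear_integral_def by (rule limitin_Hausdorff_unique)
qed

section \<open>The sewing lemma\<close>

locale almost_additive =
  fixes d :: nat and A :: "real \<Rightarrow> real \<Rightarrow> nat \<Rightarrow> real" and a b C \<theta> :: real
  assumes exponent: "\<theta> > 1" and nonneg: "C \<ge> 0"
    and defect: "\<And>s u t. \<lbrakk>a \<le> s; s \<le> u; u \<le> t; t \<le> b\<rbrakk> \<Longrightarrow>
      vnorm d (A s t - A s u - A u t) \<le> C * (t - s) powr \<theta>"
begin

text \<open>The solution of the equation in \<open>K_fixpoint\<close>, chosen so that the induction
  in \<open>chain_bound\<close> reproduces its own constant.\<close>

definition K :: real where "K = 2 * C / (1 - 2 powr (1 - \<theta>))"

lemma two_powr: "2 powr (1 - \<theta>) < 1"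
  using exponent powr_less_mono[of "1 - \<theta>" 0 2] by simp

lemma K_nonneg: "K \<ge> 0"
  using nonneg two_powr by (simp add: K_def)

lemma K_fixpoint: "2 * C + K * 2 powr (1 - \<theta>) = K"
proof -
  have "1 - 2 powr (1 - \<theta>) \<noteq> 0"
    using two_powr by linarith
  then have "K * (1 - 2 powr (1 - \<theta>)) = 2 * C"
    unfolding K_def by (rule nonzero_eq_divide_eq[THEN iffD1, OF _ refl])
  then show ?thesis by (simp add: algebra_simps)
qed

text \<open>With all three times equal the defect is \<open>- A s s\<close>, and its bound is
  \<open>0 powr \<theta> = 0\<close>.\<close>

lemma vnorm_refl: "a \<le> s \<Longrightarrow> s \<le> b \<Longrightarrow> vnorm d (A s s) = 0"
  using defect[of s s s] vnorm_uminus[of "A s s" d] by (simp add: order.antisym)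

text \<open>Here \<open>x\<close> and \<open>y\<close> stand for Riemann sums over the two outer
  pieces; the middle piece is a single step without error. Cutting at \<open>v\<close> and then at
  \<open>u\<close> costs two defects, hence \<open>2 * C\<close>. The outer pieces have at most half
  the length, so their errors add up to at most \<open>K * 2 powr (1 - \<theta>)\<close> times the
  full power.\<close>

lemma split_error:
  assumes "a \<le> s" "s \<le> u" "u \<le> v" "v \<le> t" "t \<le> b"
  assumes half: "u - s \<le> (t - s) / 2" "t - v \<le> (t - s) / 2"
    and x: "vnorm d (x - A s u) \<le> K * (u - s) powr \<theta>"
    and y: "vnorm d (y - A v t) \<le> K * (t - v) powr \<theta>"
  shows "vnorm d (x + A u v + y - A s t) \<le> K * (t - s) powr \<theta>"
proof -
  have half_powr: "2 * ((t - s) / 2) powr \<theta> = 2 powr (1 - \<theta>) * (t - s) powr \<theta>"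
    using assms by (simp add: powr_divide powr_diff)
  have "K * (u - s) powr \<theta> \<le> K * ((t - s) / 2) powr \<theta>"
    using assms exponent K_nonneg by (intro mult_left_mono powr_mono2) auto
  moreover have "K * (t - v) powr \<theta> \<le> K * ((t - s) / 2) powr \<theta>"
    using assms exponent K_nonneg by (intro mult_left_mono powr_mono2) auto
  moreover have "vnorm d (A s t - A s v - A v t) \<le> C * (t - s) powr \<theta>"
    using assms by (intro defect) auto
  moreover have "vnorm d (A s v - A s u - A u v) \<le> C * (t - s) powr \<theta>"
  proof -
    have "vnorm d (A s v - A s u - A u v) \<le> C * (v - s) powr \<theta>"
      using assms by (intro defect) auto
    also have "\<dots> \<le> C * (t - s) powr \<theta>"
      using assms exponent nonneg by (intro mult_left_mono powr_mono2) auto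
    finally show ?thesis .
  qed
  moreover have "vnorm d (x + A u v + y - A s t) \<le>
      vnorm d (x - A s u) + vnorm d (y - A v t)
      + (vnorm d (A s t - A s v - A v t) + vnorm d (A s v - A s u - A u v))"
  proof -
    have "x + A u v + y - A s t = (x - A s u) + (y - A v t)
        - ((A s t - A s v - A v t) + (A s v - A s u - A u v))"
      by (simp add: algebra_simps)
    then show ?thesis
      using vnorm_diff_le vnorm_add_le by (smt (verit))
  qed
  ultimately have "vnorm d (x + A u v + y - A s t)
      \<le> 2 * C * (t - s) powr \<theta> + K * (2 * ((t - s) / 2) powr \<theta>)"
    using x y by linarith
  also have "\<dots> = (2 * C + K * 2 powr (1 - \<theta>)) * (t - s) powr \<theta>"
    unfolding half_powr by (simp add: algebra_simps)
  finally show ?thesis unfolding K_fixpoint .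
qed

text \<open>Strong induction on the number of steps: the step across the midpoint is isolated, and
  both remaining chains are shorter. The bound does not see the number of points.\<close>

lemma chain_bound:
  fixes p :: "nat \<Rightarrow> real"
  assumes mono: "\<And>i j. i \<le> j \<Longrightarrow> j \<le> n \<Longrightarrow> p i \<le> p j" and "a \<le> p 0" "p n \<le> b"
    and "i \<le> j" "j \<le> n"
  shows "vnorm d ((\<Sum>k=i..<j. A (p k) (p (Suc k))) - A (p i) (p j)) \<le> K * (p j - p i) powr \<theta>"
  using \<open>i \<le> j\<close> \<open>j \<le> n\<close>
proof (induction "j - i" arbitrary: i j rule: less_induct)
  case less
  have bounds: "a \<le> p k \<and> p k \<le> b" if "k \<le> n" for k
    using mono[of 0 k] mono[of k n] assms(2,3) that by auto
  show ?case
  proof (cases "i = j")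
    case True
    then show ?thesis
      using vnorm_refl[of "p i"] bounds less.prems by (simp add: vnorm_uminus)
  next
    case False
    \<comment> \<open>Indices before \<open>j\<close> whose points lie in the left half. The last
      one, \<open>k\<close>, starts the step that leaves the left half or ends the chain.\<close>
    define Q where "Q = {k. i \<le> k \<and> k < j \<and> p k - p i \<le> (p j - p i) / 2}"
    define k where "k = Max Q"
    have Q: "finite Q" "i \<in> Q"
      using False less.prems mono[of i j] by (auto simp: Q_def)
    then have k: "k \<in> Q" unfolding k_def using Max_in by blast
    then have ik: "i \<le> k" "k < j" by (auto simp: Q_def)
    \<comment> \<open>By maximality of \<open>k\<close>, the index \<open>Suc k\<close> is either
      \<open>j\<close> itself or has its point in the right half.\<close>
    have right: "p j - p (Suc k) \<le> (p j - p i) / 2"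
    proof (cases "Suc k = j")
      case True
      then show ?thesis using mono[of i j] less.prems by simp
    next
      case False
      have "Suc k \<notin> Q" using Max_ge[OF Q(1), of "Suc k"] by (auto simp: k_def)
      then show ?thesis using False ik by (auto simp: Q_def field_simps)
    qed
    have "(\<Sum>k=i..<j. A (p k) (p (Suc k))) = (\<Sum>k=i..<k. A (p k) (p (Suc k)))
        + A (p k) (p (Suc k)) + (\<Sum>k=Suc k..<j. A (p k) (p (Suc k)))"
      using ik by (simp add: sum.atLeastLessThan_concat[of i k j, symmetric]
          sum.atLeast_Suc_lessThan[of k j] add.assoc)
    moreover have "vnorm d (\<dots> - A (p i) (p j)) \<le> K * (p j - p i) powr \<theta>"
    proof (rule split_error)
      show "p k - p i \<le> (p j - p i) / 2" using k by (simp add: Q_def)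
    qed (use ik less.prems mono bounds right in \<open>auto intro!: less.hyps\<close>)
    ultimately show ?thesis by simp
  qed
qed

section \<open>From finite sets of times to a whole interval\<close>

text \<open>Cumulative Riemann sums along the increasing enumeration of \<open>P\<close> work: their
  increments are chain sums, to which \<open>chain_bound\<close> applies.\<close>

lemma finite_sewing:
  assumes "finite P" "P \<subseteq> {a..b}" "a \<in> P"
  shows "\<exists>F. F a = 0 \<and> (\<forall>s\<in>P. \<forall>t\<in>P. s \<le> t \<longrightarrow> vnorm d (F t - F s - A s t) \<le> K * (t - s) powr \<theta>)"
proof -
  define xs where "xs = sorted_list_of_set P"
  define p where "p k = xs ! k" for k
  define G where "G m = (\<Sum>k<m. A (p k) (p (Suc k)))" for m
  define F where "F t = G (THE i. i < length xs \<and> p i = t)" for t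
  have xs: "set xs = P" "sorted_wrt (<) xs" "distinct xs"
    using assms by (simp_all add: xs_def)
  have len: "length xs > 0"
    using xs(1) assms(3) by auto
  have p_mono: "p i \<le> p j" if "i \<le> j" "j \<le> length xs - 1" for i j
    using xs(2) that len by (cases "i = j") (auto simp: p_def sorted_wrt_iff_nth_less less_eq_real_def)
  have p_strict: "p i < p j" if "i < j" "j < length xs" for i j
    using xs(2) that by (auto simp: p_def sorted_wrt_iff_nth_less)
  have p_in: "p i \<in> P" if "i < length xs" for i
    using that xs(1) by (auto simp: p_def)
  have F_p: "F (p i) = G i" if "i < length xs" for i
  proof -
    have "(THE j. j < length xs \<and> p j = p i) = i"
      using that p_strict by (intro the_equality) (auto, metis less_irrefl linorder_neqE_nat)
    then show ?thesis by (simp add: F_def)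
  qed
  have ex: "\<exists>i<length xs. p i = t" if "t \<in> P" for t
    using that xs(1) by (auto simp: p_def in_set_conv_nth)
  have "p 0 = a"
  proof -
    obtain i where "i < length xs" "p i = a" using ex assms(3) by blast
    then have "p 0 \<le> a" using p_mono[of 0 i] by simp
    then show ?thesis using p_in[OF len] assms(2) by fastforce
  qed
  then have "F a = 0"
    using F_p[OF len] by (simp add: G_def)
  moreover have "vnorm d (F t - F s - A s t) \<le> K * (t - s) powr \<theta>"
    if st: "s \<in> P" "t \<in> P" "s \<le> t" for s t
  proof -
    obtain i where i: "i < length xs" "p i = s"
      using ex[OF st(1)] by blast
    obtain j where j: "j < length xs" "p j = t"
      using ex[OF st(2)] by blast
    have ij: "i \<le> j"
      using p_strict[of j i] i j st(3) by force
    have "F t - F s = G j - G i" using F_p[OF i(1)] F_p[OF j(1)] unfolding i(2) j(2) by simp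
    also have "\<dots> = (\<Sum>k=i..<j. A (p k) (p (Suc k)))"
      using sum_diff_nat_ivl[of 0 i j "\<lambda>k. A (p k) (p (Suc k))"] ij
      unfolding G_def atLeast0LessThan by simp
    finally have "F t - F s = \<dots>" .
    moreover have "vnorm d (\<dots> - A (p i) (p j)) \<le> K * (p j - p i) powr \<theta>"
      using len i j ij p_in[of 0] p_in[of "length xs - 1"] assms(2)
      by (intro chain_bound[where n = "length xs - 1"] p_mono) auto
    ultimately show ?thesis using i j by simp
  qed
  ultimately show ?thesis by blast
qed

text \<open>
  The additive functions that are compatible with the germ on a finite set of times form a closed
  subset of a product of compact intervals, so that Tychonoff's theorem replaces the passage to
  the limit along partitions.
\<close>

lemma sewing:
  assumes "a \<le> b"
  shows "\<exists>F. (\<forall>t. F t \<in> Rd d) \<and> (\<forall>s t. a \<le> s \<longrightarrow> s \<le> t \<longrightarrow> t \<le> b \<longrightarrow>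
    vnorm d (F t - F s - A s t) \<le> K * (t - s) powr \<theta>)"
proof -
  \<comment> \<open>Taking \<open>s = a\<close> in the desired estimate, with
    \<open>F a = 0\<close>, confines \<open>F t i\<close> to this interval. The bound
    \<open>0\<close> from index \<open>d\<close> on forces values in \<open>Rd d\<close>.\<close>
  define B where "B t i = (if i < d then \<bar>A a t i\<bar> + K * (t - a) powr \<theta> else 0)" for t i
  define X where "X = {F. \<forall>t. F t \<in> {f. \<forall>i. f i \<in> {- B t i..B t i}}}"
  define I where "I = {(s, t). a \<le> s \<and> s \<le> t \<and> t \<le> b}"
  define Y where "Y = (\<lambda>(s, t). {F. vnorm d (F t - F s - A s t) \<le> K * (t - s) powr \<theta>})"
  \<comment> \<open>Finite intersection property: finitely many constraints mention finitely many
    times, and \<open>finite_sewing\<close> meets them all.\<close>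
  have "X \<inter> (\<Inter>z\<in>I. Y z) \<noteq> {}"
  proof (rule compact_imp_fip_image)
    show "compact X"
      unfolding X_def by (intro compact_product_UNIV compact_Icc)
    show "closed (Y z)" for z
      unfolding Y_def by (cases z) (simp add: closed_vnorm_increment_le)
    show "X \<inter> (\<Inter>z\<in>J. Y z) \<noteq> {}" if J: "finite J" "J \<subseteq> I" for J
    proof -
      \<comment> \<open>The time \<open>a\<close> is added so that the normalisation
        \<open>F a = 0\<close> yields the bound \<open>B\<close>.\<close>
      define P where "P = insert a (fst ` J \<union> snd ` J)"
      have P: "finite P" "P \<subseteq> {a..b}" "a \<in> P"
        using J assms by (auto simp: P_def I_def)
      from finite_sewing[OF this] obtain F where F: "F a = 0"
        "\<And>s t. s \<in> P \<Longrightarrow> t \<in> P \<Longrightarrow> s \<le> t \<Longrightarrow> vnorm d (F t - F s - A s t) \<le> K * (t - s) powr \<theta>"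
        by blast
      \<comment> \<open>Membership in \<open>X\<close> concerns all times and coordinates, so
        everything uncontrolled is set to \<open>0\<close>; at times in \<open>P\<close> this is
        invisible to \<open>vnorm d\<close>.\<close>
      define F' where "F' t i = (if t \<in> P \<and> i < d then F t i else 0)" for t i
      have B_nonneg: "B t i \<ge> 0" for t i
        using K_nonneg by (simp add: B_def)
      have "\<bar>F t i\<bar> \<le> B t i" if "t \<in> P" "i < d" for t i
      proof -
        have "\<bar>(F t - F a - A a t) i\<bar> \<le> vnorm d (F t - F a - A a t)"
          using that by (intro abs_le_vnorm)
        also have "\<dots> \<le> K * (t - a) powr \<theta>"
          using that P by (intro F(2)) auto
        finally show ?thesis
          using F(1) that by (simp add: B_def)
      qed
      then have "F' \<in> X"
        using B_nonneg by (fastforce simp: X_def F'_def abs_le_iff)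
      moreover have "F' \<in> Y (s, t)" if "(s, t) \<in> J" for s t
      proof -
        have st: "s \<in> P" "t \<in> P" "s \<le> t"
          using that J by (force simp: P_def I_def)+
        then have "vnorm d (F' t - F' s - A s t) = vnorm d (F t - F s - A s t)"
          by (intro L2_set_cong) (auto simp: F'_def)
        then show ?thesis
          using F(2)[OF st] by (simp add: Y_def)
      qed
      ultimately show ?thesis by auto
    qed
  qed
  then obtain F where F: "F \<in> X" "\<forall>z\<in>I. F \<in> Y z"
    by blast
  have "F t \<in> Rd d" for t
    using F(1) by (simp add: X_def B_def topspace_Euclidean_space) (smt (verit) not_less)
  then show ?thesis
    using F(2) by (intro exI[of _ F]) (auto simp: I_def Y_def)
qed

text \<open>A step of length \<open>h\<close> errs by at most \<open>K * h powr \<theta>\<close>.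
  One factor \<open>h\<close> is kept and the rest, of positive exponent
  \<open>\<theta> - 1\<close>, is bounded by the mesh; the kept factors telescope to
  \<open>t - s\<close>.\<close>

lemma riemann_sum_error:
  assumes F: "\<And>s t. \<lbrakk>a \<le> s; s \<le> t; t \<le> b\<rbrakk> \<Longrightarrow> vnorm d (F t - F s - A s t) \<le> K * (t - s) powr \<theta>"
    and st: "a \<le> s" "t \<le> b" and ts: "interval_partition s t ts"
  shows "vnorm d ((\<Sum>i<length ts - 1. A (ts ! i) (ts ! Suc i)) - (F t - F s))
    \<le> K * mesh_size ts powr (\<theta> - 1) * (t - s)"
proof -
  let ?n = "length ts - 1"
  let ?E = "\<lambda>i. A (ts ! i) (ts ! Suc i) - (F (ts ! Suc i) - F (ts ! i))"
  note nth = interval_partition_nth[OF ts]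
  have term_le: "vnorm d (?E i) \<le> K * mesh_size ts powr (\<theta> - 1) * (ts ! Suc i - ts ! i)"
    if "i < ?n" for i
  proof -
    have i: "Suc i < length ts" using that by simp
    define h where "h = ts ! Suc i - ts ! i"
    have h: "h > 0" "h \<le> mesh_size ts"
      using nth(3)[OF i] step_le_mesh_size[OF i] by (auto simp: h_def)
    have "a \<le> ts ! i" "ts ! Suc i \<le> b"
      using nth(4)[of i] nth(4)[of "Suc i"] i st by linarith+
    then have "vnorm d (?E i) \<le> K * h powr \<theta>"
      using h(1) unfolding h_def vnorm_minus_commute[of "A (ts ! i) (ts ! Suc i)"]
      by (intro F) linarith+
    also have "\<dots> = K * h powr (\<theta> - 1) * h"
      using h powr_add[of h "\<theta> - 1" 1] by simp
    also have "\<dots> \<le> K * mesh_size ts powr (\<theta> - 1) * h"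
      using h exponent K_nonneg by (intro mult_right_mono mult_left_mono powr_mono2) auto
    finally show ?thesis by (simp add: h_def)
  qed
  have "(\<Sum>i<?n. F (ts ! Suc i) - F (ts ! i)) = F t - F s"
    using sum_lessThan_telescope[of "\<lambda>i. F (ts ! i)" ?n] unfolding nth(1,2) .
  then have eq: "(\<Sum>i<?n. A (ts ! i) (ts ! Suc i)) - (F t - F s) = (\<Sum>i<?n. ?E i)"
    unfolding sum_subtractf[of "\<lambda>i. A (ts ! i) (ts ! Suc i)" "\<lambda>i. F (ts ! Suc i) - F (ts ! i)"]
    by (rule arg_cong[OF sym])
  have "vnorm d ((\<Sum>i<?n. A (ts ! i) (ts ! Suc i)) - (F t - F s)) \<le> (\<Sum>i<?n. vnorm d (?E i))"
    unfolding eq by (rule vnorm_sum_le)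
  also have "\<dots> \<le> (\<Sum>i<?n. K * mesh_size ts powr (\<theta> - 1) * (ts ! Suc i - ts ! i))"
    by (intro sum_mono term_le) simp
  also have "\<dots> = K * mesh_size ts powr (\<theta> - 1) * (\<Sum>i<?n. ts ! Suc i - ts ! i)"
    by (rule sum_distrib_left[symmetric])
  also have "(\<Sum>i<?n. ts ! Suc i - ts ! i) = t - s"
    using sum_lessThan_telescope[of "\<lambda>i. ts ! i" ?n] unfolding nth(1,2) .
  finally show ?thesis .
qed

end

section \<open>The nonlinear Young integral\<close>

text \<open>The points \<open>p\<close> and \<open>q\<close> range freely over
  \<open>[s, t]\<close>, so that \<open>mixed_increment\<close> covers both the additivity defect of
  the germ and the change of base point in \<open>nonlinear_integral_estimate\<close>.\<close>

locale nonlinear_young =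
  fixes d :: nat and W :: "real \<Rightarrow> (nat \<Rightarrow> real) \<Rightarrow> nat \<Rightarrow> real" and \<phi> :: "real \<Rightarrow> nat \<Rightarrow> real"
    and a b C \<theta> :: real
  assumes exponent: "\<theta> > 1" and nonneg: "C \<ge> 0"
    and W_Rd: "\<And>t x. x \<in> Rd d \<Longrightarrow> W t x \<in> Rd d" and \<phi>_Rd: "\<And>t. \<phi> t \<in> Rd d"
    and mixed_increment: "\<And>s u v t p q. \<lbrakk>a \<le> s; s \<le> u; u \<le> v; v \<le> t; t \<le> b; p \<in> {s..t}; q \<in> {s..t}\<rbrakk> \<Longrightarrow>
      vnorm d (W u (\<phi> p) - W v (\<phi> p) - W u (\<phi> q) + W v (\<phi> q)) \<le> C * (t - s) powr \<theta>"
begin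

sublocale almost_additive d "\<lambda>s t. W t (\<phi> s) - W s (\<phi> s)" a b C \<theta>
proof
  fix s u t
  assume st: "a \<le> s" "s \<le> u" "u \<le> t" "t \<le> b"
  have "W t (\<phi> s) - W s (\<phi> s) - (W u (\<phi> s) - W s (\<phi> s)) - (W t (\<phi> u) - W u (\<phi> u))
      = - (W u (\<phi> s) - W t (\<phi> s) - W u (\<phi> u) + W t (\<phi> u))"
    by (simp add: algebra_simps)
  then show "vnorm d (W t (\<phi> s) - W s (\<phi> s) - (W u (\<phi> s) - W s (\<phi> s)) - (W t (\<phi> u) - W u (\<phi> u)))
      \<le> C * (t - s) powr \<theta>"
    using mixed_increment[of s u t t s u] st by (simp only: vnorm_uminus) auto
qed (fact exponent nonneg)+

lemma riemann_sum_Rd: "riemann_sum W \<phi> ts \<in> Rd d"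
proof -
  have "(\<Sum>i\<in>I. W (g i) (\<phi> (f i)) - W (f i) (\<phi> (f i))) \<in> Rd d" for I :: "nat set" and f g
    using W_Rd \<phi>_Rd
    by (induction I rule: infinite_finite_induct) (simp_all add: topspace_Euclidean_space)
  then show ?thesis
    unfolding riemann_sum_def .
qed

text \<open>One \<open>F\<close> serves all subintervals at once; additivity of the integral over
  adjacent intervals is thus built in.\<close>

lemma nonlinear_integral_exists:
  assumes "a \<le> b"
  shows "\<exists>F. \<forall>s t. a \<le> s \<longrightarrow> s \<le> t \<longrightarrow> t \<le> b \<longrightarrow>
    has_nonlinear_integral d W \<phi> s t (F t - F s) \<and>
    vnorm d (F t - F s - (W t (\<phi> s) - W s (\<phi> s))) \<le> K * (t - s) powr \<theta>"
proof -
  obtain F where F: "\<And>t. F t \<in> Rd d"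
    "\<And>s t. \<lbrakk>a \<le> s; s \<le> t; t \<le> b\<rbrakk> \<Longrightarrow>
      vnorm d (F t - F s - (W t (\<phi> s) - W s (\<phi> s))) \<le> K * (t - s) powr \<theta>"
    using sewing[OF assms] by blast
  have "has_nonlinear_integral d W \<phi> s t (F t - F s)" if "a \<le> s" "s \<le> t" "t \<le> b" for s t
    unfolding has_nonlinear_integral_def
  proof (rule limitin_Euclidean_spaceI)
    show "F t - F s \<in> Rd d"
      using F(1) by (simp add: topspace_Euclidean_space)
    have "((\<lambda>ts. mesh_size ts powr (\<theta> - 1)) \<longlongrightarrow> 0) (mesh_to_zero s t)"
      using exponent
      by (intro tendsto_zero_powrI[OF mesh_size_tendsto_zero tendsto_const])
        (auto simp: mesh_size_nonneg)
    then have lim: "((\<lambda>ts. K * mesh_size ts powr (\<theta> - 1) * (t - s)) \<longlongrightarrow> 0) (mesh_to_zero s t)"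
      by (intro tendsto_mult_left_zero tendsto_mult_right_zero)
    have "\<forall>\<^sub>F ts in mesh_to_zero s t. norm (vnorm d (riemann_sum W \<phi> ts - (F t - F s)))
        \<le> K * mesh_size ts powr (\<theta> - 1) * (t - s)"
      \<comment> \<open>The mesh bound \<open>1\<close> is an arbitrary choice: the error estimate
        holds for every partition.\<close>
      unfolding eventually_mesh_to_zero riemann_sum_def
      using riemann_sum_error[of F s t] F(2) that by (intro exI[of _ 1]) simp
    from this lim show "((\<lambda>ts. vnorm d (riemann_sum W \<phi> ts - (F t - F s))) \<longlongrightarrow> 0) (mesh_to_zero s t)"
      by (rule Lim_null_comparison)
  qed (rule riemann_sum_Rd)
  with F(2) show ?thesis by blast
qed

text \<open>Cutting at \<open>c\<close> leaves two germ errors, \<open>x\<close> on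
  \<open>[s, c]\<close> and \<open>y\<close> on \<open>[c, t]\<close>. The germ on
  \<open>[s, c]\<close> is based at \<open>s\<close>; moving its base point to \<open>c\<close>
  costs the mixed increment \<open>z\<close>. This explains \<open>2 * K + C\<close>.\<close>

lemma nonlinear_integral_estimate:
  assumes "a \<le> s" "s \<le> c" "c \<le> t" "t \<le> b"
  shows "vnorm d (nonlinear_integral d W \<phi> s t - W t (\<phi> c) + W s (\<phi> c))
    \<le> (2 * K + C) * (t - s) powr \<theta>"
proof -
  obtain F where F: "\<And>s t. \<lbrakk>a \<le> s; s \<le> t; t \<le> b\<rbrakk> \<Longrightarrow> has_nonlinear_integral d W \<phi> s t (F t - F s)"
    "\<And>s t. \<lbrakk>a \<le> s; s \<le> t; t \<le> b\<rbrakk> \<Longrightarrow>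
      vnorm d (F t - F s - (W t (\<phi> s) - W s (\<phi> s))) \<le> K * (t - s) powr \<theta>"
    using nonlinear_integral_exists assms by (meson order_trans)
  define x where "x = F c - F s - (W c (\<phi> s) - W s (\<phi> s))"
  define y where "y = F t - F c - (W t (\<phi> c) - W c (\<phi> c))"
  define z where "z = W s (\<phi> s) - W c (\<phi> s) - W s (\<phi> c) + W c (\<phi> c)"
  have "nonlinear_integral d W \<phi> s t = F t - F s"
    using assms F(1) by (intro nonlinear_integral_eqI) auto
  then have eq: "nonlinear_integral d W \<phi> s t - W t (\<phi> c) + W s (\<phi> c) = x + y - z"
    by (simp add: x_def y_def z_def algebra_simps)
  have "vnorm d x \<le> K * (t - s) powr \<theta>"
  proof -
    have "vnorm d x \<le> K * (c - s) powr \<theta>"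
      unfolding x_def using assms by (intro F(2)) auto
    also have "\<dots> \<le> K * (t - s) powr \<theta>"
      using assms exponent K_nonneg by (intro mult_left_mono powr_mono2) auto
    finally show ?thesis .
  qed
  moreover have "vnorm d y \<le> K * (t - s) powr \<theta>"
  proof -
    have "vnorm d y \<le> K * (t - c) powr \<theta>"
      unfolding y_def using assms by (intro F(2)) auto
    also have "\<dots> \<le> K * (t - s) powr \<theta>"
      using assms exponent K_nonneg by (intro mult_left_mono powr_mono2) auto
    finally show ?thesis .
  qed
  moreover have "vnorm d z \<le> C * (t - s) powr \<theta>"
    unfolding z_def using assms by (intro mixed_increment) auto
  moreover have "vnorm d (x + y - z) \<le> vnorm d x + vnorm d y + vnorm d z"
    using vnorm_diff_le vnorm_add_le by (smt (verit))
  ultimately show ?thesis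
    unfolding eq distrib_right by linarith
qed

end

section \<open>Bounds from the seminorms\<close>

text \<open>Passage from suprema in \<open>ennreal\<close> to real inequalities. Finiteness matters
  since \<open>enn2real\<close> sends infinity to \<open>0\<close>.\<close>

lemma le_enn2real_mult:
  assumes "ennreal (v / D) \<le> S" "S < \<infinity>" "D > 0" "v \<ge> 0"
  shows "v \<le> enn2real S * D"
proof -
  have "v / D \<le> enn2real S"
    using enn2real_mono[OF assms(1)] assms by simp
  then show ?thesis
    using \<open>D > 0\<close> by (simp add: pos_divide_le_eq)
qed

lemma W_seminorm_mixed_le:
  assumes fin: "W_seminorm d \<beta> \<tau> lam a b W < \<infinity>"
    and st: "a \<le> s" "s \<le> t" "t \<le> b" and xy: "x \<in> Rd d" "y \<in> Rd d"
  shows "vnorm d (W s x - W t x - W s y + W t y) \<le> enn2real (W_seminorm d \<beta> \<tau> lam a b W)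
    * ((1 + vnorm d x + vnorm d y) powr \<beta> * (t - s) powr \<tau> * vnorm d (x - y) powr lam)"
\<comment> \<open>The supremum ranges over \<open>s < t\<close> and distinct points; in the
  degenerate cases the increment vanishes.\<close>
proof (cases "s = t \<or> x = y")
  case True
  then have "W s x - W t x - W s y + W t y = 0" by auto
  then have "vnorm d (W s x - W t x - W s y + W t y) = 0"
    by (simp only:) (simp add: L2_set_def)
  then show ?thesis
    by (simp only:) (intro mult_nonneg_nonneg powr_ge_zero enn2real_nonneg)
next
  case False
  let ?D = "(1 + vnorm d x + vnorm d y) powr \<beta> * \<bar>t - s\<bar> powr \<tau> * vnorm d (x - y) powr lam"
  let ?f = "\<lambda>(s, t, x, y). ennreal (vnorm d (W s x - W t x - W s y + W t y)
    / ((1 + vnorm d x + vnorm d y) powr \<beta> * \<bar>t - s\<bar> powr \<tau> * vnorm d (x - y) powr lam))"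
  let ?A = "{(s, t, x, y). a \<le> s \<and> s < t \<and> t \<le> b \<and> x \<in> Rd d \<and> y \<in> Rd d \<and> x \<noteq> y}"
  have "1 + vnorm d x + vnorm d y > 0"
    using L2_set_nonneg[of x "{..<d}"] L2_set_nonneg[of y "{..<d}"] by linarith
  then have D: "?D > 0"
    using False vnorm_pos[OF xy] by (intro mult_pos_pos) auto
  have "(s, t, x, y) \<in> ?A"
    using False st xy by simp
  then have "?f (s, t, x, y) \<le> (SUP z\<in>?A. ?f z)"
    by (rule SUP_upper)
  also have "\<dots> \<le> W_seminorm d \<beta> \<tau> lam a b W"
    unfolding W_seminorm_def
    by (rule add_increasing2[OF zero_le add_increasing2[OF zero_le order_refl]])
  finally have "ennreal (vnorm d (W s x - W t x - W s y + W t y) / ?D) \<le> W_seminorm d \<beta> \<tau> lam a b W"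
    by (simp only: prod.case)
  then have "vnorm d (W s x - W t x - W s y + W t y) \<le> enn2real (W_seminorm d \<beta> \<tau> lam a b W) * ?D"
    using fin D by (intro le_enn2real_mult L2_set_nonneg)
  then show ?thesis using st by simp
qed

lemma holder_seminorm_le:
  assumes fin: "holder_seminorm d \<gamma> a b \<phi> < \<infinity>" and st: "s \<in> {a..b}" "t \<in> {a..b}"
  shows "vnorm d (\<phi> t - \<phi> s) \<le> enn2real (holder_seminorm d \<gamma> a b \<phi>) * \<bar>t - s\<bar> powr \<gamma>"
proof -
  have *: "vnorm d (\<phi> t - \<phi> s) \<le> enn2real (holder_seminorm d \<gamma> a b \<phi>) * \<bar>t - s\<bar> powr \<gamma>"
    if "a \<le> s" "s < t" "t \<le> b" for s t
  proof (intro le_enn2real_mult L2_set_nonneg)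
    show "ennreal (vnorm d (\<phi> t - \<phi> s) / \<bar>t - s\<bar> powr \<gamma>) \<le> holder_seminorm d \<gamma> a b \<phi>"
      unfolding holder_seminorm_def by (rule SUP_upper2[of "(s, t)"]) (use that in auto)
  qed (use that fin in auto)
  consider "s < t" | "t < s" | "s = t" by linarith
  then show ?thesis
  proof cases
    case 2
    then show ?thesis
      using *[of t s] st by (simp only: vnorm_minus_commute[of "\<phi> t"] abs_minus_commute[of t]) auto
  next
    case 3
    then have "vnorm d (\<phi> t - \<phi> s) = 0" by (simp add: L2_set_def)
    with 3 show ?thesis by simp
  qed (use * st in auto)
qed

text \<open>The Holder bound relative to the endpoint \<open>a\<close> makes the supremum finite, so
  its real value is a true bound.\<close>

lemma vnorm_le_sup_norm:
  assumes fin: "holder_seminorm d \<gamma> a b \<phi> < \<infinity>" and "0 \<le> \<gamma>" and t: "t \<in> {a..b}"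
  shows "vnorm d (\<phi> t) \<le> enn2real (sup_norm d a b \<phi>)"
proof -
  define B where "B = vnorm d (\<phi> a) + enn2real (holder_seminorm d \<gamma> a b \<phi>) * (b - a) powr \<gamma>"
  have "vnorm d (\<phi> r) \<le> B" if r: "r \<in> {a..b}" for r
  proof -
    have "vnorm d (\<phi> r) \<le> vnorm d (\<phi> a) + vnorm d (\<phi> r - \<phi> a)"
      using vnorm_add_le[of "\<phi> a" "\<phi> r - \<phi> a" d] by simp
    also have "vnorm d (\<phi> r - \<phi> a) \<le> enn2real (holder_seminorm d \<gamma> a b \<phi>) * \<bar>r - a\<bar> powr \<gamma>"
      using r by (intro holder_seminorm_le[OF fin]) auto
    also have "\<dots> \<le> enn2real (holder_seminorm d \<gamma> a b \<phi>) * (b - a) powr \<gamma>"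
      using r \<open>0 \<le> \<gamma>\<close> by (intro mult_left_mono powr_mono2) auto
    finally show ?thesis by (simp add: B_def)
  qed
  then have "sup_norm d a b \<phi> \<le> ennreal B"
    unfolding sup_norm_def by (intro SUP_least ennreal_leI)
  then have "sup_norm d a b \<phi> < \<infinity>"
    by (rule order_le_less_trans) simp
  moreover have "ennreal (vnorm d (\<phi> t) / 1) \<le> sup_norm d a b \<phi>"
    unfolding sup_norm_def div_by_1 using t by (rule SUP_upper)
  ultimately have "vnorm d (\<phi> t) \<le> enn2real (sup_norm d a b \<phi>) * 1"
    by (intro le_enn2real_mult L2_set_nonneg) auto
  then show ?thesis by simp
qed

text \<open>If \<open>M \<le> 1\<close> the base is at most \<open>3\<close>, and the summand
  \<open>1\<close> alone suffices, whatever the value of \<open>0 powr 0\<close>; otherwise the base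
  is at most \<open>3 * M\<close>.\<close>

lemma one_plus_double_powr_le:
  fixes M \<beta> :: real
  assumes "0 \<le> M" "0 \<le> \<beta>"
  shows "(1 + 2 * M) powr \<beta> \<le> 3 powr \<beta> * (1 + M powr \<beta>)"
proof (cases "M \<le> 1")
  case True
  have "(1 + 2 * M) powr \<beta> \<le> 3 powr \<beta> * 1"
    using True assms by (simp add: powr_mono2)
  also have "\<dots> \<le> 3 powr \<beta> * (1 + M powr \<beta>)"
    by (intro mult_left_mono) auto
  finally show ?thesis .
next
  case False
  then have "(1 + 2 * M) powr \<beta> \<le> (3 * M) powr \<beta>"
    using assms by (intro powr_mono2) auto
  also have "\<dots> = 3 powr \<beta> * M powr \<beta>"
    using assms by (simp add: powr_mult)
  also have "\<dots> \<le> 3 powr \<beta> * (1 + M powr \<beta>)"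
    by (intro mult_left_mono) auto
  finally show ?thesis .
qed

text \<open>The sup norm controls the spatial weight, at the price of \<open>3 powr \<beta>\<close>.
  The time increment contributes the exponent \<open>\<tau>\<close>, and the Holder bound on
  \<open>\<phi>\<close> raised to the power \<open>lam\<close> contributes
  \<open>lam * \<gamma>\<close>.\<close>

lemma nonlinear_young_Holder:
  fixes \<tau> lam \<beta> \<gamma> :: real
  assumes exps: "0 < \<tau>" "0 < lam" "0 \<le> \<beta>" "0 < \<gamma>" "\<tau> + lam * \<gamma> > 1"
    and Rd: "\<And>t x. x \<in> Rd d \<Longrightarrow> W t x \<in> Rd d" "\<And>t. \<phi> t \<in> Rd d"
    and W_fin: "W_seminorm d \<beta> \<tau> lam a b W < \<infinity>"
    and \<phi>_fin: "holder_seminorm d \<gamma> a b \<phi> < \<infinity>"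
  shows "nonlinear_young d W \<phi> a b
    (3 powr \<beta> * (enn2real (W_seminorm d \<beta> \<tau> lam a b W) * (1 + enn2real (sup_norm d a b \<phi>) powr \<beta>)
      * enn2real (holder_seminorm d \<gamma> a b \<phi>) powr lam)) (\<tau> + lam * \<gamma>)"
proof -
  define N where "N = enn2real (W_seminorm d \<beta> \<tau> lam a b W)"
  define M where "M = enn2real (sup_norm d a b \<phi>)"
  define H where "H = enn2real (holder_seminorm d \<gamma> a b \<phi>)"
  have nonneg: "N \<ge> 0" "M \<ge> 0" "H \<ge> 0"
    by (simp_all add: N_def M_def H_def)
  have "nonlinear_young d W \<phi> a b (3 powr \<beta> * (N * (1 + M powr \<beta>) * H powr lam)) (\<tau> + lam * \<gamma>)"
  proof
    fix s u v t p q
    assume *: "a \<le> s" "s \<le> u" "u \<le> v" "v \<le> t" "t \<le> b" "p \<in> {s..t}" "q \<in> {s..t}"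
    have pq: "p \<in> {a..b}" "q \<in> {a..b}" using * by auto
    have "vnorm d (W u (\<phi> p) - W v (\<phi> p) - W u (\<phi> q) + W v (\<phi> q)) \<le>
        N * ((1 + vnorm d (\<phi> p) + vnorm d (\<phi> q)) powr \<beta> * (v - u) powr \<tau> * vnorm d (\<phi> p - \<phi> q) powr lam)"
      unfolding N_def using * Rd(2) by (intro W_seminorm_mixed_le W_fin) auto
    also have "\<dots> \<le> N * (3 powr \<beta> * (1 + M powr \<beta>) * (t - s) powr \<tau> * (H powr lam * (t - s) powr (lam * \<gamma>)))"
    proof (intro mult_left_mono mult_mono)
      have "vnorm d (\<phi> p) \<le> M" "vnorm d (\<phi> q) \<le> M"
        unfolding M_def using pq exps by (auto intro: vnorm_le_sup_norm[OF \<phi>_fin])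
      then have "(1 + vnorm d (\<phi> p) + vnorm d (\<phi> q)) powr \<beta> \<le> (1 + 2 * M) powr \<beta>"
        using exps by (intro powr_mono2) auto
      also have "\<dots> \<le> 3 powr \<beta> * (1 + M powr \<beta>)"
        using nonneg exps by (intro one_plus_double_powr_le)
      finally show "(1 + vnorm d (\<phi> p) + vnorm d (\<phi> q)) powr \<beta> \<le> 3 powr \<beta> * (1 + M powr \<beta>)" .
      show "(v - u) powr \<tau> \<le> (t - s) powr \<tau>"
        using * exps by (intro powr_mono2) auto
      have "vnorm d (\<phi> p - \<phi> q) \<le> H * \<bar>p - q\<bar> powr \<gamma>"
        unfolding H_def using pq by (intro holder_seminorm_le[OF \<phi>_fin])
      also have "\<dots> \<le> H * (t - s) powr \<gamma>"
        using * exps nonneg by (intro mult_left_mono powr_mono2) auto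
      finally have "vnorm d (\<phi> p - \<phi> q) powr lam \<le> (H * (t - s) powr \<gamma>) powr lam"
        using exps by (intro powr_mono2) auto
      also have "\<dots> = H powr lam * (t - s) powr (lam * \<gamma>)"
        using nonneg by (simp add: powr_mult powr_powr mult.commute)
      finally show "vnorm d (\<phi> p - \<phi> q) powr lam \<le> H powr lam * (t - s) powr (lam * \<gamma>)" .
    qed (use nonneg in auto)
    also have "\<dots> = 3 powr \<beta> * (N * (1 + M powr \<beta>) * H powr lam) * (t - s) powr (\<tau> + lam * \<gamma>)"
      by (simp add: powr_add)
    finally show "vnorm d (W u (\<phi> p) - W v (\<phi> p) - W u (\<phi> q) + W v (\<phi> q))
        \<le> 3 powr \<beta> * (N * (1 + M powr \<beta>) * H powr lam) * (t - s) powr (\<tau> + lam * \<gamma>)" .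
  qed (use exps nonneg Rd in auto)
  then show ?thesis unfolding N_def M_def H_def .
qed

theorem proposition2p4:
  fixes \<tau> lam \<beta> \<gamma> :: real
  assumes "0 < \<tau>" "\<tau> \<le> 1" and "0 < lam" "lam \<le> 1" and "0 \<le> \<beta>"
    and "0 < \<gamma>" "\<gamma> \<le> 1" and "\<tau> + lam * \<gamma> > 1"
  shows "\<exists>\<kappa>::real. \<forall>(d::nat) (W :: real \<Rightarrow> (nat \<Rightarrow> real) \<Rightarrow> (nat \<Rightarrow> real)) (\<phi> :: real \<Rightarrow> (nat \<Rightarrow> real)).
    (\<forall>t. \<forall>x\<in>Rd d. W t x \<in> Rd d) \<and> (\<forall>t. \<phi> t \<in> Rd d)
    \<and> (\<forall>a b. a < b \<longrightarrow> W_seminorm d \<beta> \<tau> lam a b W < \<infinity>)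
    \<and> (\<forall>a b. a < b \<longrightarrow> holder_seminorm d \<gamma> a b \<phi> < \<infinity>)
    \<longrightarrow> (\<forall>a b. a < b \<longrightarrow>
          (\<exists>l. has_nonlinear_integral d W \<phi> a b l)
          \<and> (\<forall>s c t. a \<le> s \<and> s \<le> c \<and> c \<le> t \<and> t \<le> b \<longrightarrow>
               vnorm d (nonlinear_integral d W \<phi> s t - W t (\<phi> c) + W s (\<phi> c))
               \<le> \<kappa> * enn2real (W_seminorm d \<beta> \<tau> lam a b W)
                   * (1 + enn2real (sup_norm d a b \<phi>) powr \<beta>)
                   * enn2real (holder_seminorm d \<gamma> a b \<phi>) powr lam
                   * (t - s) powr (\<tau> + lam * \<gamma>)))"
\<comment> \<open>With \<open>C\<close> the constant of \<open>nonlinear_young_Holder\<close>,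
  \<open>2 * K + C\<close> equals \<open>C * (4 / (1 - 2 powr (1 - \<theta>)) + 1)\<close>. The
  factor \<open>3 powr \<beta>\<close> of \<open>C\<close> goes into \<open>\<kappa>\<close>, and
  the norms remain.\<close>
proof (rule exI[of _ "3 powr \<beta> * (4 / (1 - 2 powr (1 - (\<tau> + lam * \<gamma>))) + 1)"], intro allI impI conjI)
  let ?\<theta> = "\<tau> + lam * \<gamma>"
  let ?\<kappa> = "3 powr \<beta> * (4 / (1 - 2 powr (1 - ?\<theta>)) + 1)"
  fix d W \<phi> and a b :: real
  assume "(\<forall>t. \<forall>x\<in>Rd d. W t x \<in> Rd d) \<and> (\<forall>t. \<phi> t \<in> Rd d)
    \<and> (\<forall>a b. a < b \<longrightarrow> W_seminorm d \<beta> \<tau> lam a b W < \<infinity>)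
    \<and> (\<forall>a b. a < b \<longrightarrow> holder_seminorm d \<gamma> a b \<phi> < \<infinity>)" and "a < b"
  then interpret nonlinear_young d W \<phi> a b
    "3 powr \<beta> * (enn2real (W_seminorm d \<beta> \<tau> lam a b W) * (1 + enn2real (sup_norm d a b \<phi>) powr \<beta>)
      * enn2real (holder_seminorm d \<gamma> a b \<phi>) powr lam)" ?\<theta>
    using assms by (intro nonlinear_young_Holder) auto
  show "\<exists>l. has_nonlinear_integral d W \<phi> a b l"
    using nonlinear_integral_exists \<open>a < b\<close> by (meson less_imp_le order_refl)
  fix s c t
  assume "a \<le> s \<and> s \<le> c \<and> c \<le> t \<and> t \<le> b"
  then have "vnorm d (nonlinear_integral d W \<phi> s t - W t (\<phi> c) + W s (\<phi> c))
    \<le> (2 * K + 3 powr \<beta> * (enn2real (W_seminorm d \<beta> \<tau> lam a b W) * (1 + enn2real (sup_norm d a b \<phi>) powr \<beta>)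
      * enn2real (holder_seminorm d \<gamma> a b \<phi>) powr lam)) * (t - s) powr ?\<theta>"
    by (intro nonlinear_integral_estimate) auto
  also have "\<dots> = ?\<kappa> * enn2real (W_seminorm d \<beta> \<tau> lam a b W) * (1 + enn2real (sup_norm d a b \<phi>) powr \<beta>)
      * enn2real (holder_seminorm d \<gamma> a b \<phi>) powr lam * (t - s) powr ?\<theta>"
    unfolding K_def by (simp add: algebra_simps)
  finally show "vnorm d (nonlinear_integral d W \<phi> s t - W t (\<phi> c) + W s (\<phi> c))
    \<le> ?\<kappa> * enn2real (W_seminorm d \<beta> \<tau> lam a b W) * (1 + enn2real (sup_norm d a b \<phi>) powr \<beta>)
      * enn2real (holder_seminorm d \<gamma> a b \<phi>) powr lam * (t - s) powr ?\<theta>" .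
qed

end
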